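(* Consider, for a Runge-Kutta method with $s$ stages and real Butcher coefficients $A \in \mathbb{R}^{s\times s}$, $b \in \mathbb{R}^s$, $c \in \mathbb{R}^s$, the following two statements. (i) The Runge-Kutta method is $A$-, $L$-, $B$-, and algebraically stable, its nodes $c_i \in [0,1]$ are pairwise distinct, all its quadrature weights $b_i$ are positive, and the matrix $A$ is invertible. (ii) The Runge-Kutta method is the one induced by an SBP SAT scheme whose SBP operator $(D,M,t_L,t_R)$ is at least first order accurate and satisfies the eigenvalue assumption. Then (ii) together with the condition that $M$ is diagonal implies (i). However, (i) does not imply (ii), i.e. there exists a Runge-Kutta method satisfying (i) but not (ii).
   Context: SBP operators. Let $T>0$ and let $0 \le \tau_1 < \dots < \tau_s \le T$ be a grid. An SBP (summation by parts) operator of order $p \in \mathbb{N}$, $p \ge 1$, on $[0,T]$ consists of: a matrix $D \in \mathbb{R}^{s\times s}$ approximating the derivative with order of accuracy $p$ (exact on nodal values of polynomials of degree $\le p$); a symmetric positive definite matrix $M \in \mathbb{R}^{s\times s}$ (with $u^T M v$ interpreted as an approximation of $\int_0^T u v\,dt$); and vectors $t_L,t_R \in \mathbb{R}^s$ with $t_L^T u \approx u(0)$, $t_R^T u \approx u(T)$ of order of accuracy at least $p$ (exact on nodal values of polynomials of degree $\le p$); such that $M D + D^T M = t_R t_R^T - t_L t_L^T$. "At least first order accurate" means order $p\ge 1$. Eigenvalue assumption: for every $\sigma > \frac12$, all eigenvalues of $D + \sigma M^{-1} t_L t_L^T$ have strictly positive real part. SBP SAT scheme. For the ODE $u'(t)=f(t,u(t))$,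 $u(0)=u_0$, the scheme is $D u = f + M^{-1} t_L (u_0 - t_L^T u)$ with $u=(u_i)_i$, $f = (f(\tau_i,u_i))_i$, and the numerical solution at time $T$ is $t_R^T u$. Under the eigenvalue assumption, the Runge-Kutta method induced by it is the one with Butcher coefficients $$A = \tfrac1T (D + M^{-1} t_L t_L^T)^{-1}, \quad b = \tfrac1T M \mathbf{1}, \quad c = \tfrac1T(\tau_1,\dots,\tau_s)^T,$$ where $\mathbf{1} = (1,\dots,1)^T \in \mathbb{R}^s$. Stability notions for a Runge-Kutta method $(A,b,c)$. The stability function is $R(z) = 1 + z b^T(\mathrm{I} - zA)^{-1}\mathbf{1} = \det(\mathrm{I} - zA + z\mathbf{1}b^T)/\det(\mathrm{I} - zA)$. The method is $A$-stable if $|R(z)| \le 1$ for all $z \in \mathbb{C}$ with $\operatorname{Re} z \le 0$; it is $L$-stable if it is $A$-stable and $\lim_{z\to\infty} R(z) = 0$. It is $B$-stable if, for every ODE in a Hilbert space whose right-hand side satisfies $\langle f(t,u)-f(t,v), u-v\rangle \le \nu \|u-v\|^2$ for all $t,u,v$ with some $\nu \le 0$, one has $\|u_+ - v_+\| \le \|u_0 - v_0\|$ for all step sizes $\Delta t>0$, where $u_+,v_+$ are the results of one step of the method started from $u_0,v_0$. It is algebraically stable if $b_i \ge 0$ for all $i$ and the matrix $\operatorname{diag}(b)A + A^T\operatorname{diag}(b) - b b^T$ is positive semidefinite. *)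

theory Defs
  imports "HOL-Analysis.Inner_Product"
    "Jordan_Normal_Form.Gauss_Jordan_Elimination"
    "Jordan_Normal_Form.Char_Poly"
begin

text \<open>All vectors and matrices are those of Jordan_Normal_Form, with explicit carriers
  \<^term>\<open>carrier_vec s\<close> and \<^term>\<open>carrier_mat s s\<close>, so that the number of stages \<open>s\<close> is an
  ordinary natural number. Indices run from \<open>0\<close> to \<open>s - 1\<close>.\<close>

text \<open>Unspecified if the matrix is not invertible.\<close>

definition mat_inv :: "'a :: field mat \<Rightarrow> 'a mat" where
  "mat_inv A = the (mat_inverse A)"

definition ones :: "nat \<Rightarrow> 'a :: one vec" where
  "ones s = vec s (\<lambda>_. 1)"

text \<open>The rank-one matrix \<open>u v\<^sup>T\<close>.\<close>

definition outer :: "'a :: times vec \<Rightarrow> 'a vec \<Rightarrow> 'a mat" where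
  "outer u v = mat (dim_vec u) (dim_vec v) (\<lambda>(i, j). u $ i * v $ j)"

definition symmetric_mat :: "'a mat \<Rightarrow> bool" where
  "symmetric_mat Q \<longleftrightarrow> transpose_mat Q = Q"

definition pos_semidef :: "nat \<Rightarrow> real mat \<Rightarrow> bool" where
  "pos_semidef s Q \<longleftrightarrow> Q \<in> carrier_mat s s \<and> symmetric_mat Q \<and>
     (\<forall>x \<in> carrier_vec s. 0 \<le> scalar_prod x (Q *\<^sub>v x))"

definition pos_def :: "nat \<Rightarrow> real mat \<Rightarrow> bool" where
  "pos_def s Q \<longleftrightarrow> Q \<in> carrier_mat s s \<and> symmetric_mat Q \<and>
     (\<forall>x \<in> carrier_vec s. x \<noteq> 0\<^sub>v s \<longrightarrow> 0 < scalar_prod x (Q *\<^sub>v x))"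


subsection \<open>SBP operators and the SBP SAT scheme\<close>

definition grid :: "real \<Rightarrow> nat \<Rightarrow> real vec \<Rightarrow> bool" where
  "grid T s \<tau> \<longleftrightarrow> \<tau> \<in> carrier_vec s \<and> (\<forall>i < s. 0 \<le> \<tau> $ i \<and> \<tau> $ i \<le> T) \<and>
     (\<forall>i j. i < j \<and> j < s \<longrightarrow> \<tau> $ i < \<tau> $ j)"

definition nodal_values :: "real vec \<Rightarrow> real poly \<Rightarrow> real vec" where
  "nodal_values \<tau> q = map_vec (poly q) \<tau>"

text \<open>An SBP operator of order of accuracy (at least) \<open>p\<close> on \<open>[0, T]\<close>.\<close>

definition sbp_operator ::
  "real \<Rightarrow> nat \<Rightarrow> real vec \<Rightarrow> nat \<Rightarrow> real mat \<Rightarrow> real mat \<Rightarrow> real vec \<Rightarrow> real vec \<Rightarrow> bool" where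
  "sbp_operator T s \<tau> p D M t\<^sub>L t\<^sub>R \<longleftrightarrow>
     0 < T \<and> grid T s \<tau> \<and> 1 \<le> p \<and>
     D \<in> carrier_mat s s \<and> pos_def s M \<and> t\<^sub>L \<in> carrier_vec s \<and> t\<^sub>R \<in> carrier_vec s \<and>
     (\<forall>q. degree q \<le> p \<longrightarrow>
        D *\<^sub>v nodal_values \<tau> q = nodal_values \<tau> (pderiv q) \<and>
        scalar_prod t\<^sub>L (nodal_values \<tau> q) = poly q 0 \<and>
        scalar_prod t\<^sub>R (nodal_values \<tau> q) = poly q T) \<and>
     M * D + transpose_mat D * M = outer t\<^sub>R t\<^sub>R - outer t\<^sub>L t\<^sub>L"

definition eigenvalue_assumption :: "real mat \<Rightarrow> real mat \<Rightarrow> real vec \<Rightarrow> bool" where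
  "eigenvalue_assumption D M t\<^sub>L \<longleftrightarrow>
     (\<forall>\<sigma> :: real. \<sigma> > 1 / 2 \<longrightarrow>
        (\<forall>\<mu> :: complex.
           eigenvalue (map_mat complex_of_real (D + \<sigma> \<cdot>\<^sub>m (mat_inv M * outer t\<^sub>L t\<^sub>L))) \<mu> \<longrightarrow>
           0 < Re \<mu>))"


subsection \<open>Runge-Kutta methods and their stability properties\<close>

definition runge_kutta :: "nat \<Rightarrow> real mat \<Rightarrow> real vec \<Rightarrow> real vec \<Rightarrow> bool" where
  "runge_kutta s A b c \<longleftrightarrow>
     1 \<le> s \<and> A \<in> carrier_mat s s \<and> b \<in> carrier_vec s \<and> c \<in> carrier_vec s"

text \<open>\<open>(A, b, c)\<close> is the Runge-Kutta method induced by an SBP SAT scheme with mass matrix \<open>M\<close>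
  whose operator is at least first order accurate and satisfies the eigenvalue assumption.
  The mass matrix is exposed so that it can additionally be required to be diagonal.\<close>

definition induced_by_sbp_sat ::
  "nat \<Rightarrow> real mat \<Rightarrow> real vec \<Rightarrow> real vec \<Rightarrow> real mat \<Rightarrow> bool" where
  "induced_by_sbp_sat s A b c M \<longleftrightarrow>
     (\<exists>T \<tau> p D t\<^sub>L t\<^sub>R.
        1 \<le> p \<and> sbp_operator T s \<tau> p D M t\<^sub>L t\<^sub>R \<and> eigenvalue_assumption D M t\<^sub>L \<and>
        A = (1 / T) \<cdot>\<^sub>m mat_inv (D + mat_inv M * outer t\<^sub>L t\<^sub>L) \<and>
        b = (1 / T) \<cdot>\<^sub>v (M *\<^sub>v ones s) \<and>
        c = (1 / T) \<cdot>\<^sub>v \<tau>)"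

definition stage_mat :: "nat \<Rightarrow> real mat \<Rightarrow> complex \<Rightarrow> complex mat" where
  "stage_mat s A z = 1\<^sub>m s - z \<cdot>\<^sub>m map_mat complex_of_real A"

definition stability_function ::
  "nat \<Rightarrow> real mat \<Rightarrow> real vec \<Rightarrow> complex \<Rightarrow> complex" where
  "stability_function s A b z =
     1 + z * scalar_prod (map_vec complex_of_real b) (mat_inv (stage_mat s A z) *\<^sub>v ones s)"

text \<open>The bound is only meaningful where the stability function is defined; this is part of
  the requirement.\<close>

definition A_stable :: "nat \<Rightarrow> real mat \<Rightarrow> real vec \<Rightarrow> bool" where
  "A_stable s A b \<longleftrightarrow>
     (\<forall>z. Re z \<le> 0 \<longrightarrow>
        invertible_mat (stage_mat s A z) \<and> cmod (stability_function s A b z) \<le> 1)"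

text \<open>For every \<open>A\<close>, the matrix \<^term>\<open>stage_mat s A z\<close> is singular for at most finitely many \<open>z\<close>,
  so the stability function is defined near infinity.\<close>

definition L_stable :: "nat \<Rightarrow> real mat \<Rightarrow> real vec \<Rightarrow> bool" where
  "L_stable s A b \<longleftrightarrow>
     A_stable s A b \<and> (stability_function s A b \<longlongrightarrow> 0) at_infinity"

text \<open>\<open>u\<^sub>1\<close> is a result of one step of size \<open>h\<close> from \<open>(t\<^sub>0, u\<^sub>0)\<close>. For an implicit method the stage
  values \<open>U\<close> need neither exist nor be unique, hence a relation.\<close>

definition rk_step ::
  "nat \<Rightarrow> real mat \<Rightarrow> real vec \<Rightarrow> real vec \<Rightarrow> (real \<Rightarrow> 'h \<Rightarrow> 'h :: real_vector) \<Rightarrow>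
   real \<Rightarrow> real \<Rightarrow> 'h \<Rightarrow> 'h \<Rightarrow> bool" where
  "rk_step s A b c f h t\<^sub>0 u\<^sub>0 u\<^sub>1 \<longleftrightarrow>
     (\<exists>U :: nat \<Rightarrow> 'h.
        (\<forall>i < s. U i = u\<^sub>0 + h *\<^sub>R (\<Sum>j < s. (A $$ (i, j)) *\<^sub>R f (t\<^sub>0 + c $ j * h) (U j))) \<and>
        u\<^sub>1 = u\<^sub>0 + h *\<^sub>R (\<Sum>j < s. (b $ j) *\<^sub>R f (t\<^sub>0 + c $ j * h) (U j)))"

text \<open>B-stability for all ODEs in the Hilbert space \<open>'h\<close>.\<close>

definition B_stable ::
  "'h :: {real_inner, complete_space} itself \<Rightarrow> nat \<Rightarrow> real mat \<Rightarrow> real vec \<Rightarrow> real vec \<Rightarrow> bool" where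
  "B_stable _ s A b c \<longleftrightarrow>
     (\<forall>f :: real \<Rightarrow> 'h \<Rightarrow> 'h.
        (\<exists>\<nu> \<le> 0. \<forall>t u v. inner (f t u - f t v) (u - v) \<le> \<nu> * (norm (u - v))\<^sup>2) \<longrightarrow>
        (\<forall>h t\<^sub>0 u\<^sub>0 v\<^sub>0 u\<^sub>1 v\<^sub>1.
           0 < h \<and> rk_step s A b c f h t\<^sub>0 u\<^sub>0 u\<^sub>1 \<and> rk_step s A b c f h t\<^sub>0 v\<^sub>0 v\<^sub>1 \<longrightarrow>
           norm (u\<^sub>1 - v\<^sub>1) \<le> norm (u\<^sub>0 - v\<^sub>0)))"

definition algebraically_stable :: "nat \<Rightarrow> real mat \<Rightarrow> real vec \<Rightarrow> bool" where
  "algebraically_stable s A b \<longleftrightarrow>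
     (\<forall>i < s. 0 \<le> b $ i) \<and>
     pos_semidef s
       (mat_diag s (vec_index b) * A + transpose_mat A * mat_diag s (vec_index b) - outer b b)"

text \<open>The type argument is the Hilbert space in which B-stability is tested. HOL cannot quantify
  over types inside a formula, so B-stability in every Hilbert space is expressed by a free type
  variable. To obtain from \<open>\<exists>s A b c. stable_rk TYPE('h) s A b c \<and> \<dots>\<close> a method that works in all
  Hilbert spaces at once, the existence claim has to be accompanied by
  \<open>stable_rk TYPE('h) s A b c \<longrightarrow> stable_rk TYPE('k) s A b c\<close> for all \<open>s A b c\<close>.\<close>

definition stable_rk ::
  "'h :: {real_inner, complete_space} itself \<Rightarrow> nat \<Rightarrow> real mat \<Rightarrow> real vec \<Rightarrow> real vec \<Rightarrow> bool" where
  "stable_rk H s A b c \<longleftrightarrow>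
     A_stable s A b \<and> L_stable s A b \<and> B_stable H s A b c \<and> algebraically_stable s A b \<and>
     (\<forall>i < s. 0 \<le> c $ i \<and> c $ i \<le> 1) \<and>
     (\<forall>i < s. \<forall>j < s. i \<noteq> j \<longrightarrow> c $ i \<noteq> c $ j) \<and>
     (\<forall>i < s. 0 < b $ i) \<and>
     invertible_mat A"

end

theory Submission
  imports Defs
begin

text \<open>Everything rests on one energy estimate. If a vector of increments \<open>d\<close> is advanced by
  an algebraically stable method with slopes \<open>F\<^sub>i\<close> at stages \<open>U\<^sub>i\<close>, the squared norm of the result
  differs from \<open>\<parallel>d\<parallel>\<^sup>2\<close> by \<open>2 h \<Sum> b\<^sub>i \<langle>F\<^sub>i, U\<^sub>i\<rangle>\<close> minus \<open>h\<^sup>2\<close> times the algebraic stability form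
  evaluated on the Gram matrix of the slopes. A positive semidefinite real form is nonnegative on
  every Gram matrix (\<open>pos_semidef_gram_nonneg\<close>), so the step is contractive as soon as
  all \<open>\<langle>F\<^sub>i, U\<^sub>i\<rangle> \<le> 0\<close> (\<open>algebraically_stable_contractive\<close>). Differences of two solutions give
  B-stability in every real Hilbert space. The linear test equation in the plane, that is,
  \<^typ>\<open>complex\<close> as a real Hilbert space, gives \<open>\<bar>R z\<bar> \<le> 1\<close> wherever the stages are solvable in the
  left half plane. Since B-stability in one Hilbert space is thereby a consequence of algebraic
  stability, which mentions no Hilbert space, it transfers to any other.

  For an SBP SAT scheme put \<open>B = D + M\<^sup>-\<^sup>1 t\<^sub>L t\<^sub>L\<^sup>T\<close>, so that \<open>T B\<close> is the inverse of the Butcher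
  matrix. Summation by parts says \<open>M B + (M B)\<^sup>T = t\<^sub>R t\<^sub>R\<^sup>T + t\<^sub>L t\<^sub>L\<^sup>T\<close>; applying it to
  \<open>1 = (1, \<dots>, 1)\<^sup>T\<close>, with \<open>D 1 = 0\<close>, leaves \<open>(M B)\<^sup>T 1 = t\<^sub>R\<close>. If \<open>M\<close> is diagonal, then
  \<open>diag b = M / T\<close>, and the algebraic stability form at \<open>B y\<close> equals \<open>(t\<^sub>L\<^sup>T y)\<^sup>2 / T\<^sup>2\<close>:
  the square \<open>(t\<^sub>R\<^sup>T y)\<^sup>2\<close> cancels against \<open>b b\<^sup>T\<close>. The eigenvalue assumption at \<open>\<sigma> = 1\<close> makes
  the stage equations solvable in the left half plane. Finally \<open>b\<^sup>T A\<^sup>-\<^sup>1 1 = t\<^sub>R\<^sup>T 1 = 1\<close>, which is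
  what makes \<open>R\<close> vanish at infinity (\<open>stability_function_tendsto_0\<close>).

  The implicit Euler method has all the stability properties but a single stage, while
  a first order accurate derivative operator needs at least two nodes to tell a linear function from
  a constant one.\<close>

section \<open>Inverse matrices and coordinates\<close>

lemma mat_inv_inverts:
  fixes A :: "'a :: field mat"
  assumes A: "A \<in> carrier_mat n n" and inv: "invertible_mat A"
  shows "mat_inv A \<in> carrier_mat n n" "A * mat_inv A = 1\<^sub>m n" "mat_inv A * A = 1\<^sub>m n"
proof -
  obtain B where AB: "A * B = 1\<^sub>m n" and BA: "B * A = 1\<^sub>m (dim_row B)"
    using inv A unfolding invertible_mat_def inverts_mat_def by auto
  have B: "B \<in> carrier_mat n n"
    using arg_cong[OF AB, of dim_col] arg_cong[OF BA, of dim_col] A by auto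
  have "A \<in> Units (ring_mat TYPE('a) n ())"
    unfolding Units_def using A B AB BA by (auto simp: ring_mat_simps)
  then obtain C where "mat_inverse A = Some C"
    using mat_inverse(1)[OF A, where b = "()"] by (cases "mat_inverse A") simp_all
  with mat_inverse(2)[OF A this] show "mat_inv A \<in> carrier_mat n n"
    "A * mat_inv A = 1\<^sub>m n" "mat_inv A * A = 1\<^sub>m n"
    by (simp_all add: mat_inv_def)
qed

lemma invertible_mat_if_trivial_kernel:
  fixes A :: "'a :: field mat"
  assumes A: "A \<in> carrier_mat n n"
    and ker: "\<And>v. v \<in> carrier_vec n \<Longrightarrow> A *\<^sub>v v = 0\<^sub>v n \<Longrightarrow> v = 0\<^sub>v n"
  shows "invertible_mat A"
proof -
  have "det A \<noteq> 0" using det_0_iff_vec_prod_zero[OF A] ker by blast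
  from det_non_zero_imp_unit[OF A this, of "()"] obtain B
    where "B \<in> carrier_mat n n" "A * B = 1\<^sub>m n" "B * A = 1\<^sub>m n"
    unfolding Units_def by (auto simp: ring_mat_simps)
  then show ?thesis using A unfolding invertible_mat_def inverts_mat_def by auto
qed

lemma invertible_matI:
  assumes "A \<in> carrier_mat n n" "C \<in> carrier_mat n n" "A * C = 1\<^sub>m n" "C * A = 1\<^sub>m n"
  shows "invertible_mat A"
  using assms unfolding invertible_mat_def inverts_mat_def by auto

lemma mult_mat_vec_index:
  assumes "A \<in> carrier_mat n m" "x \<in> carrier_vec m" "i < n"
  shows "(A *\<^sub>v x) $ i = (\<Sum>j<m. A $$ (i, j) * x $ j)"
  using assms by (auto simp: scalar_prod_def lessThan_atLeast0)

lemma smult_mat_mult_vec: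
  fixes A :: "'a :: comm_semiring_0 mat"
  assumes "A \<in> carrier_mat n m" "x \<in> carrier_vec m"
  shows "(a \<cdot>\<^sub>m A) *\<^sub>v x = a \<cdot>\<^sub>v (A *\<^sub>v x)"
  using assms by (intro eq_vecI) (auto simp: scalar_prod_def sum_distrib_left mult.assoc)

lemma ones_carrier: "ones s \<in> carrier_vec s"
  by (simp add: ones_def)

lemma scalar_prod_sum:
  assumes "y \<in> carrier_vec n"
  shows "scalar_prod x y = (\<Sum>i<n. x $ i * y $ i)"
  using assms by (auto simp: scalar_prod_def lessThan_atLeast0)

section \<open>Positive semidefinite forms on Gram matrices\<close>

lemma inner_scaled_sum_self:
  fixes k :: "'i \<Rightarrow> 'h :: real_inner"
  shows "inner (\<Sum>i\<in>S. a i *\<^sub>R k i) (\<Sum>i\<in>S. a i *\<^sub>R k i) =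
    (\<Sum>i\<in>S. \<Sum>j\<in>S. a i * a j * inner (k i) (k j))"
  by (subst inner_sum_left) (simp add: inner_sum_right sum_distrib_left mult_ac)

text \<open>One step of the Cholesky decomposition. It is stated for vectors \<open>k i\<close> of an inner product
  space, so that the same identity serves for scalars (the hypothesis on \<open>q\<close>) and for
  vectors (the conclusion).\<close>

lemma complete_square_inner:
  fixes k :: "'i \<Rightarrow> 'h :: real_inner"
  assumes fin: "finite S" and a: "a \<notin> S" and d: "q a a \<noteq> 0"
    and sym: "\<And>i. i \<in> S \<Longrightarrow> q i a = q a i"
  shows "(\<Sum>i\<in>insert a S. \<Sum>j\<in>insert a S. q i j * inner (k i) (k j)) =
      q a a * (norm (k a + (1 / q a a) *\<^sub>R (\<Sum>j\<in>S. q a j *\<^sub>R k j)))\<^sup>2 +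
      (\<Sum>i\<in>S. \<Sum>j\<in>S. (q i j - q a i * q a j / q a a) * inner (k i) (k j))"
proof -
  define w where "w = (\<Sum>j\<in>S. q a j *\<^sub>R k j)"
  have ww: "inner w w = (\<Sum>i\<in>S. \<Sum>j\<in>S. q a i * q a j * inner (k i) (k j))"
    unfolding w_def by (rule inner_scaled_sum_self)
  have aw: "inner (k a) w = (\<Sum>j\<in>S. q a j * inner (k a) (k j))"
    unfolding w_def by (simp add: inner_sum_right)
  have "(\<Sum>i\<in>insert a S. \<Sum>j\<in>insert a S. q i j * inner (k i) (k j)) =
     q a a * inner (k a) (k a) + 2 * inner (k a) w +
     (\<Sum>i\<in>S. \<Sum>j\<in>S. q i j * inner (k i) (k j))"
  proof -
    have "(\<Sum>i\<in>S. q i a * inner (k i) (k a)) = inner (k a) w"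
      unfolding aw by (intro sum.cong refl) (simp add: sym inner_commute)
    then show ?thesis using fin a by (simp add: aw[symmetric] sum.distrib)
  qed
  moreover have "(\<Sum>i\<in>S. \<Sum>j\<in>S. (q i j - q a i * q a j / q a a) * inner (k i) (k j)) =
      (\<Sum>i\<in>S. \<Sum>j\<in>S. q i j * inner (k i) (k j)) - inner w w / q a a"
    by (simp add: ww sum_subtractf left_diff_distrib sum_divide_distrib)
  moreover have "q a a * (norm (k a + (1 / q a a) *\<^sub>R w))\<^sup>2 =
      q a a * inner (k a) (k a) + 2 * inner (k a) w + inner w w / q a a"
    using d by (simp add: power2_norm_eq_inner inner_add_left inner_add_right
        inner_commute[of w "k a"] field_simps)
  ultimately show ?thesis unfolding w_def by simp
qed

text \<open>A positive semidefinite form is a sum of squares of linear forms, and these squares remain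
  nonnegative when scalars are replaced by vectors and products by inner products. The induction
  splits off one square at a time.\<close>

lemma pos_semidef_gram_nonneg:
  fixes k :: "'i \<Rightarrow> 'h :: real_inner"
  assumes "finite S"
    and "\<And>i j. i \<in> S \<Longrightarrow> j \<in> S \<Longrightarrow> q i j = q j i"
    and "\<And>x :: 'i \<Rightarrow> real. 0 \<le> (\<Sum>i\<in>S. \<Sum>j\<in>S. q i j * (x i * x j))"
  shows "0 \<le> (\<Sum>i\<in>S. \<Sum>j\<in>S. q i j * inner (k i) (k j))"
  using assms
proof (induction S arbitrary: q rule: finite_induct)
  case (insert a S)
  note sym = insert.prems(1) and psd = insert.prems(2)
  have col: "q i a = q a i" if "i \<in> S" for i using sym[of i a] that by simp
  have split: "(\<Sum>i\<in>insert a S. \<Sum>j\<in>insert a S. q i j * (x i * x j)) =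
     q a a * (x a)\<^sup>2 + 2 * x a * (\<Sum>j\<in>S. q a j * x j) + (\<Sum>i\<in>S. \<Sum>j\<in>S. q i j * (x i * x j))"
    for x :: "'i \<Rightarrow> real"
    using insert.hyps
    by (simp add: col sum.distrib sum_distrib_left power2_eq_square mult_ac)
  have "0 \<le> q a a"
    using psd[of "\<lambda>i. if i = a then 1 else 0"] insert.hyps
    by (simp add: sum.delta if_distrib[of "\<lambda>x. _ * x"] cong: if_cong)
  then consider "q a a = 0" | "0 < q a a" by linarith
  then show ?case
  proof cases
    case 1
    \<comment> \<open>The form is affine in the entry at \<open>a\<close>, so boundedness from below forces the whole row
      of \<open>a\<close> to vanish.\<close>
    have row: "q a j = 0" if j: "j \<in> S" for j
    proof (rule ccontr)
      assume nz: "q a j \<noteq> 0"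
      \<comment> \<open>chosen so that the form takes the value \<open>-1\<close> at the vector with entries
        \<open>t\<close> at \<open>a\<close> and \<open>1\<close> at \<open>j\<close>\<close>
      define t where "t = - (q j j + 1) / (2 * q a j)"
      define e where "e l = (if l = a then t else if l = j then 1 else 0)" for l
      have e: "e l = (if l = j then 1 else 0)" if "l \<in> S" for l
        using that insert.hyps by (auto simp: e_def)
      have s1: "(\<Sum>i\<in>S. q a i * e i) = q a j"
      proof -
        have "(\<Sum>i\<in>S. q a i * e i) = (\<Sum>i\<in>S. if i = j then q a i else 0)"
          by (intro sum.cong refl) (simp add: e)
        then show ?thesis using j insert.hyps by simp
      qed
      have s2: "(\<Sum>i\<in>S. \<Sum>l\<in>S. q i l * (e i * e l)) = q j j"
      proof -
        have "(\<Sum>i\<in>S. \<Sum>l\<in>S. q i l * (e i * e l)) =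
          (\<Sum>i\<in>S. \<Sum>l\<in>S. if l = j then (if i = j then q i l else 0) else 0)"
          by (intro sum.cong refl) (simp add: e)
        then show ?thesis using j insert.hyps by simp
      qed
      have "0 \<le> 2 * t * q a j + q j j"
        using psd[of e] unfolding split s1 s2 using 1 by (simp add: e_def)
      also have "\<dots> = -1" using nz by (simp add: t_def field_simps)
      finally show False by simp
    qed
    have "0 \<le> (\<Sum>i\<in>S. \<Sum>j\<in>S. q i j * inner (k i) (k j))"
    proof (rule insert.IH)
      fix x :: "'i \<Rightarrow> real"
      show "0 \<le> (\<Sum>i\<in>S. \<Sum>j\<in>S. q i j * (x i * x j))"
        using psd[of x] unfolding split by (simp add: 1 row)
    qed (rule sym; simp)
    moreover have "(\<Sum>i\<in>insert a S. \<Sum>j\<in>insert a S. q i j * inner (k i) (k j)) =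
        (\<Sum>i\<in>S. \<Sum>j\<in>S. q i j * inner (k i) (k j))"
      using insert.hyps by (simp add: 1 row col)
    ultimately show ?thesis by simp
  next
    case 2
    \<comment> \<open>The Schur complement of the entry \<open>q a a\<close> is positive semidefinite again: the value
      chosen at \<open>a\<close> makes the completed square vanish.\<close>
    have "0 \<le> (\<Sum>i\<in>S. \<Sum>j\<in>S. (q i j - q a i * q a j / q a a) * inner (k i) (k j))"
    proof (rule insert.IH)
      fix x :: "'i \<Rightarrow> real"
      define y where "y = x(a := - (1 / q a a) * (\<Sum>j\<in>S. q a j * x j))"
      have y: "y j = x j" if "j \<in> S" for j using that insert.hyps by (auto simp: y_def)
      have "0 \<le> (\<Sum>i\<in>insert a S. \<Sum>j\<in>insert a S. q i j * inner (y i) (y j))"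
        using psd[of y] by simp
      also have "\<dots> = (\<Sum>i\<in>S. \<Sum>j\<in>S. (q i j - q a i * q a j / q a a) * inner (y i) (y j))"
      proof -
        have "(\<Sum>j\<in>S. q a j *\<^sub>R y j) = (\<Sum>j\<in>S. q a j * x j)" using y by simp
        then show ?thesis
          using insert.hyps 2 col by (subst complete_square_inner) (simp_all add: y_def)
      qed
      also have "\<dots> = (\<Sum>i\<in>S. \<Sum>j\<in>S. (q i j - q a i * q a j / q a a) * (x i * x j))"
        using y by simp
      finally show "0 \<le> (\<Sum>i\<in>S. \<Sum>j\<in>S. (q i j - q a i * q a j / q a a) * (x i * x j))" .
    next
      fix i j assume "i \<in> S" "j \<in> S"
      then show "q i j - q a i * q a j / q a a = q j i - q a j * q a i / q a a"
        using sym[of i j] by simp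
    qed
    moreover have "0 \<le> q a a * (norm (k a + (1 / q a a) *\<^sub>R (\<Sum>j\<in>S. q a j *\<^sub>R k j)))\<^sup>2"
      using 2 by simp
    ultimately show ?thesis
      using insert.hyps 2 col by (subst complete_square_inner) simp_all
  qed
qed simp

section \<open>Algebraic stability implies contractivity\<close>

lemma algebraic_stability_entry:
  fixes A :: "real mat"
  assumes "A \<in> carrier_mat s s" "b \<in> carrier_vec s" "i < s" "j < s"
  shows "(mat_diag s (vec_index b) * A + transpose_mat A * mat_diag s (vec_index b) - outer b b)
      $$ (i, j) = b $ i * A $$ (i, j) + b $ j * A $$ (j, i) - b $ i * b $ j"
  using assms
  by (simp add: mat_diag_mult_left[of A s s] mat_diag_mult_right[of "transpose_mat A" s s] outer_def
      mult.commute)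

lemma algebraically_stable_gram:
  fixes k :: "nat \<Rightarrow> 'h :: real_inner"
  assumes A: "A \<in> carrier_mat s s" and b: "b \<in> carrier_vec s"
    and stab: "algebraically_stable s A b"
  shows "0 \<le> (\<Sum>i<s. \<Sum>j<s. (b $ i * A $$ (i, j) + b $ j * A $$ (j, i) - b $ i * b $ j) *
                inner (k i) (k j))"
proof (rule pos_semidef_gram_nonneg)
  let ?Q = "mat_diag s (vec_index b) * A + transpose_mat A * mat_diag s (vec_index b) - outer b b"
  have Q: "?Q \<in> carrier_mat s s" using b by (auto simp: outer_def)
  fix x :: "nat \<Rightarrow> real"
  have "0 \<le> scalar_prod (vec s x) (?Q *\<^sub>v vec s x)"
    using stab by (simp add: algebraically_stable_def pos_semidef_def)
  also have "\<dots> = (\<Sum>i<s. x i * (\<Sum>j<s. ?Q $$ (i, j) * x j))"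
    by (simp add: scalar_prod_sum[OF mult_mat_vec_carrier[OF Q vec_carrier]] mult_mat_vec_index[OF Q]
        del: index_mult_mat_vec index_add_mat index_minus_mat index_mult_mat)
  also have "\<dots> = (\<Sum>i<s. \<Sum>j<s.
      (b $ i * A $$ (i, j) + b $ j * A $$ (j, i) - b $ i * b $ j) * (x i * x j))"
    unfolding sum_distrib_left
    by (intro sum.cong refl) (simp only: algebraic_stability_entry[OF A b] lessThan_iff mult_ac)
  finally show "0 \<le> \<dots>" .
qed auto

text \<open>Substituting \<open>d = U\<^sub>i - h \<Sum>\<^sub>j A\<^sub>i\<^sub>j F\<^sub>j\<close> in the cross terms of
  \<open>\<parallel>d + h \<Sum>\<^sub>i b\<^sub>i F\<^sub>i\<parallel>\<^sup>2\<close> produces the dissipative terms \<open>b\<^sub>i \<langle>F\<^sub>i, U\<^sub>i\<rangle>\<close> and leaves the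
  algebraic stability form of the slopes. The slopes \<open>F\<close> are left abstract, so that
  differences of a nonlinear right-hand side and complex multiplication are both instances.\<close>

lemma algebraically_stable_contractive:
  fixes U F :: "nat \<Rightarrow> 'h :: real_inner"
  assumes A: "A \<in> carrier_mat s s" and b: "b \<in> carrier_vec s"
    and stab: "algebraically_stable s A b" and h: "0 \<le> h"
    and U: "\<And>i. i < s \<Longrightarrow> U i = d + h *\<^sub>R (\<Sum>j<s. A $$ (i, j) *\<^sub>R F j)"
    and e: "e = d + h *\<^sub>R (\<Sum>j<s. b $ j *\<^sub>R F j)"
    and diss: "\<And>i. i < s \<Longrightarrow> inner (F i) (U i) \<le> 0"
  shows "norm e \<le> norm d"
proof -
  define w where "w = (\<Sum>j<s. b $ j *\<^sub>R F j)"
  define g where "g i j = b $ i * (A $$ (i, j) * inner (F i) (F j))" for i j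
  have "inner w d = (\<Sum>i<s. b $ i * inner (F i) (U i)) - h * (\<Sum>i<s. \<Sum>j<s. g i j)"
  proof -
    have "b $ i * inner (F i) (U i) = b $ i * inner (F i) d + h * (\<Sum>j<s. g i j)" if "i < s" for i
      using U[OF that] by (simp add: g_def inner_add_right inner_sum_right sum_distrib_left algebra_simps)
    then show ?thesis
      by (simp add: w_def inner_sum_left sum.distrib sum_distrib_left)
  qed
  moreover have "(\<Sum>i<s. b $ i * inner (F i) (U i)) \<le> 0"
    using stab diss by (intro sum_nonpos) (auto simp: algebraically_stable_def mult_nonneg_nonpos)
  ultimately have wd: "inner w d \<le> - h * (\<Sum>i<s. \<Sum>j<s. g i j)" by simp
  have ww: "inner w w = (\<Sum>i<s. \<Sum>j<s. b $ i * b $ j * inner (F i) (F j))"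
    unfolding w_def by (rule inner_scaled_sum_self)
  have "0 \<le> (\<Sum>i<s. \<Sum>j<s. (b $ i * A $$ (i, j) + b $ j * A $$ (j, i) - b $ i * b $ j) *
                inner (F i) (F j))"
    by (rule algebraically_stable_gram[OF A b stab])
  also have "\<dots> = (\<Sum>i<s. \<Sum>j<s. g i j) + (\<Sum>i<s. \<Sum>j<s. g j i) - inner w w"
    unfolding ww sum.distrib[symmetric] sum_subtractf[symmetric]
    by (intro sum.cong refl) (simp add: g_def inner_commute algebra_simps)
  also have "(\<Sum>i<s. \<Sum>j<s. g j i) = (\<Sum>i<s. \<Sum>j<s. g i j)" by (rule sum.swap)
  finally have gram: "inner w w \<le> 2 * (\<Sum>i<s. \<Sum>j<s. g i j)" by simp
  have "(norm e)\<^sup>2 = (norm d)\<^sup>2 + 2 * h * inner w d + h * (h * inner w w)"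
    unfolding e w_def[symmetric]
    by (simp add: power2_norm_eq_inner inner_add_left inner_add_right inner_commute algebra_simps)
  also have "\<dots> \<le> (norm d)\<^sup>2 + 2 * h * (- h * (\<Sum>i<s. \<Sum>j<s. g i j)) +
      h * (h * (2 * (\<Sum>i<s. \<Sum>j<s. g i j)))"
    using h wd gram by (intro add_mono mult_left_mono) auto
  also have "\<dots> = (norm d)\<^sup>2" by (simp add: algebra_simps)
  finally show ?thesis by (rule power2_le_imp_le) simp
qed

lemma algebraically_stable_imp_B_stable:
  assumes A: "A \<in> carrier_mat s s" and b: "b \<in> carrier_vec s"
    and stab: "algebraically_stable s A b"
  shows "B_stable TYPE('h :: {real_inner, complete_space}) s A b c"
  unfolding B_stable_def rk_step_def
proof (intro allI impI, elim conjE exE)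
  fix f :: "real \<Rightarrow> 'h \<Rightarrow> 'h" and h t\<^sub>0 \<nu> :: real and u\<^sub>0 v\<^sub>0 u\<^sub>1 v\<^sub>1 :: 'h and U V :: "nat \<Rightarrow> 'h"
  assume \<nu>: "\<nu> \<le> 0" "\<forall>t u v. inner (f t u - f t v) (u - v) \<le> \<nu> * (norm (u - v))\<^sup>2" and h: "0 < h"
    and U: "\<forall>i<s. U i = u\<^sub>0 + h *\<^sub>R (\<Sum>j<s. A $$ (i, j) *\<^sub>R f (t\<^sub>0 + c $ j * h) (U j))"
    and V: "\<forall>i<s. V i = v\<^sub>0 + h *\<^sub>R (\<Sum>j<s. A $$ (i, j) *\<^sub>R f (t\<^sub>0 + c $ j * h) (V j))"
    and u1: "u\<^sub>1 = u\<^sub>0 + h *\<^sub>R (\<Sum>j<s. b $ j *\<^sub>R f (t\<^sub>0 + c $ j * h) (U j))"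
    and v1: "v\<^sub>1 = v\<^sub>0 + h *\<^sub>R (\<Sum>j<s. b $ j *\<^sub>R f (t\<^sub>0 + c $ j * h) (V j))"
  define F where "F j = f (t\<^sub>0 + c $ j * h) (U j) - f (t\<^sub>0 + c $ j * h) (V j)" for j
  show "norm (u\<^sub>1 - v\<^sub>1) \<le> norm (u\<^sub>0 - v\<^sub>0)"
  proof (rule algebraically_stable_contractive[OF A b stab, where h = h and F = F
        and U = "\<lambda>i. U i - V i"])
    show "U i - V i = u\<^sub>0 - v\<^sub>0 + h *\<^sub>R (\<Sum>j<s. A $$ (i, j) *\<^sub>R F j)" if "i < s" for i
      using U V that by (simp add: F_def scaleR_diff_right sum_subtractf)
    show "u\<^sub>1 - v\<^sub>1 = u\<^sub>0 - v\<^sub>0 + h *\<^sub>R (\<Sum>j<s. b $ j *\<^sub>R F j)"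
      unfolding u1 v1 by (simp add: F_def scaleR_diff_right sum_subtractf)
    show "inner (F i) (U i - V i) \<le> 0" for i
    proof -
      have "inner (F i) (U i - V i) \<le> \<nu> * (norm (U i - V i))\<^sup>2" using \<nu>(2) by (simp add: F_def)
      also have "\<dots> \<le> 0" using \<nu>(1) by (simp add: mult_nonpos_nonneg)
      finally show ?thesis .
    qed
  qed (use h in simp)
qed

section \<open>The stability function\<close>

lemma stage_mat_carrier: "stage_mat s A z \<in> carrier_mat s s"
  if "A \<in> carrier_mat s s"
  using that unfolding stage_mat_def by (intro minus_carrier_mat) auto

text \<open>The stability function is the result of one step of size \<open>1\<close> for \<open>u' = z u\<close>, \<open>u 0 = 1\<close>,
  with stage values \<open>x\<close>.\<close>

lemma stability_function_stages:
  assumes A: "A \<in> carrier_mat s s" and b: "b \<in> carrier_vec s"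
    and inv: "invertible_mat (stage_mat s A z)"
  obtains x :: "nat \<Rightarrow> complex"
  where "\<And>i. i < s \<Longrightarrow> x i = 1 + z * (\<Sum>j<s. A $$ (i, j) * x j)"
    and "stability_function s A b z = 1 + z * (\<Sum>j<s. b $ j * x j)"
proof
  let ?S = "stage_mat s A z"
  let ?x = "mat_inv ?S *\<^sub>v (ones s :: complex vec)"
  note S = stage_mat_carrier[OF A, of z]
  have o: "(ones s :: complex vec) \<in> carrier_vec s" by (rule ones_carrier)
  have x: "?x \<in> carrier_vec s" using mat_inv_inverts(1)[OF S inv] o by simp
  have Sx: "?S *\<^sub>v ?x = ones s"
    using assoc_mult_mat_vec[OF S mat_inv_inverts(1)[OF S inv] o] mat_inv_inverts(2)[OF S inv] o
    by simp
  show "?x $ i = 1 + z * (\<Sum>j<s. A $$ (i, j) * ?x $ j)" if i: "i < s" for i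
  proof -
    have "1 = (?S *\<^sub>v ?x) $ i" using i by (simp only: Sx) (simp add: ones_def)
    also have "\<dots> = (\<Sum>j<s. (if i = j then ?x $ j else 0) - z * (A $$ (i, j) * ?x $ j))"
      unfolding mult_mat_vec_index[OF S x i] using A i
      by (intro sum.cong refl) (simp add: stage_mat_def left_diff_distrib del: index_mult_mat_vec)
    also have "\<dots> = ?x $ i - z * (\<Sum>j<s. A $$ (i, j) * ?x $ j)"
      using i by (simp add: sum_subtractf sum_distrib_left del: index_mult_mat_vec)
    finally show ?thesis by (simp add: algebra_simps del: index_mult_mat_vec)
  qed
  show "stability_function s A b z = 1 + z * (\<Sum>j<s. b $ j * ?x $ j)"
    unfolding stability_function_def scalar_prod_sum[OF x] using b
    by (simp del: index_mult_mat_vec)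
qed

text \<open>Multiplication by \<open>z\<close> with \<open>Re z \<le> 0\<close> is dissipative for the real inner product on the
  complex plane, since \<open>\<langle>z x, x\<rangle> = Re z \<bar>x\<bar>\<^sup>2\<close>. Solvability of the stage equations has to be assumed:
  on the imaginary axis algebraic stability does not exclude singular stage matrices.\<close>

lemma algebraically_stable_imp_A_stable:
  assumes A: "A \<in> carrier_mat s s" and b: "b \<in> carrier_vec s"
    and stab: "algebraically_stable s A b"
    and inv: "\<And>z. Re z \<le> 0 \<Longrightarrow> invertible_mat (stage_mat s A z)"
  shows "A_stable s A b"
  unfolding A_stable_def
proof (intro allI impI conjI)
  fix z assume z: "Re z \<le> 0"
  note inv = inv[OF z]
  show "invertible_mat (stage_mat s A z)" by (rule inv)
  obtain x :: "nat \<Rightarrow> complex" where x: "\<And>i. i < s \<Longrightarrow> x i = 1 + z * (\<Sum>j<s. A $$ (i, j) * x j)"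
    and R: "stability_function s A b z = 1 + z * (\<Sum>j<s. b $ j * x j)"
    by (rule stability_function_stages[OF A b inv]) (rule that)
  have "norm (stability_function s A b z) \<le> norm (1 :: complex)"
  proof (rule algebraically_stable_contractive[OF A b stab, where h = 1 and U = x
        and F = "\<lambda>i. z * x i"])
    show "x i = 1 + 1 *\<^sub>R (\<Sum>j<s. A $$ (i, j) *\<^sub>R (z * x j))" if "i < s" for i
      unfolding x[OF that] by (simp add: scaleR_conv_of_real sum_distrib_left mult.left_commute)
    show "stability_function s A b z = 1 + 1 *\<^sub>R (\<Sum>j<s. b $ j *\<^sub>R (z * x j))"
      unfolding R by (simp add: scaleR_conv_of_real sum_distrib_left mult.left_commute)
    show "inner (z * x i) (x i) \<le> 0" for i
    proof -
      have "inner (z * x i) (x i) = Re z * (norm (x i))\<^sup>2"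
        unfolding inner_complex_def cmod_power2 by (simp add: algebra_simps power2_eq_square)
      then show ?thesis using z by (simp add: mult_nonpos_nonneg)
    qed
  qed simp
  then show "cmod (stability_function s A b z) \<le> 1" by simp
qed

text \<open>If \<open>v = z A v\<close> then \<open>A\<^sup>-\<^sup>1 v = z v\<close>. Passing to the inverse avoids the case \<open>z = 0\<close>, in
  which \<open>1 / z\<close> is no eigenvalue of \<open>A\<close>.\<close>

lemma singular_stage_mat_imp_eigenvalue_inverse:
  assumes A: "A \<in> carrier_mat s s" and C: "C \<in> carrier_mat s s" and CA: "C * A = 1\<^sub>m s"
    and sing: "\<not> invertible_mat (stage_mat s A z)"
  shows "eigenvalue (map_mat complex_of_real C) z"
proof -
  let ?A = "map_mat complex_of_real A" and ?C = "map_mat complex_of_real C"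
  have cA: "?A \<in> carrier_mat s s" and cC: "?C \<in> carrier_mat s s" using A C by auto
  have "?C * ?A = map_mat complex_of_real (C * A)"
    by (rule of_real_hom.mat_hom_mult[OF C A, symmetric])
  then have CA': "?C * ?A = 1\<^sub>m s" by (simp add: CA of_real_hom.mat_hom_one)
  obtain v where v: "v \<in> carrier_vec s" "v \<noteq> 0\<^sub>v s" and Sv: "stage_mat s A z *\<^sub>v v = 0\<^sub>v s"
    using sing invertible_mat_if_trivial_kernel[OF stage_mat_carrier[OF A]] by blast
  have "v - z \<cdot>\<^sub>v (?A *\<^sub>v v) = 0\<^sub>v s"
    using Sv v(1) cA by (simp add: stage_mat_def minus_mult_distrib_mat_vec[of _ s s]
        smult_mat_mult_vec[OF cA])
  then have vA: "v = z \<cdot>\<^sub>v (?A *\<^sub>v v)"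
    using v(1) cA by (auto simp: vec_eq_iff simp del: index_mult_mat_vec)
  have "?C *\<^sub>v v = z \<cdot>\<^sub>v (?C *\<^sub>v (?A *\<^sub>v v))"
    by (subst vA) (rule mult_mat_vec[OF cC mult_mat_vec_carrier[OF cA v(1)]])
  also have "?C *\<^sub>v (?A *\<^sub>v v) = v"
    using assoc_mult_mat_vec[OF cC cA v(1)] CA' v(1) by simp
  finally show ?thesis using v cC unfolding eigenvalue_def eigenvector_def by auto
qed

text \<open>Write \<open>C = A\<^sup>-\<^sup>1\<close>. The stage values satisfy \<open>z x = C x - C 1\<close>, whence
  \<open>R z = 1 + b\<^sup>T C x - b\<^sup>T C 1 = b\<^sup>T C x\<close>. With the entrywise sum norm \<open>K\<close> of \<open>C\<close> the same
  relation gives \<open>\<bar>z\<bar> \<parallel>x\<parallel> \<le> K \<parallel>x\<parallel> + K\<close>, so the stages, and with them \<open>R z\<close>, decay like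
  \<open>1 / \<bar>z\<bar>\<close>.\<close>

lemma stability_function_tendsto_0:
  assumes A: "A \<in> carrier_mat s s" and b: "b \<in> carrier_vec s" and C: "C \<in> carrier_mat s s"
    and CA: "C * A = 1\<^sub>m s" and row: "scalar_prod b (C *\<^sub>v ones s) = 1"
  shows "(stability_function s A b \<longlongrightarrow> 0) at_infinity"
proof -
  define K where "K = (\<Sum>i<s. \<Sum>j<s. \<bar>C $$ (i, j)\<bar>)"
  define P where "P = (\<Sum>i<s. \<bar>b $ i\<bar> * (\<Sum>j<s. \<bar>C $$ (i, j)\<bar>))"
  have row_bound: "cmod (\<Sum>j<s. C $$ (i, j) * y j) \<le> (\<Sum>j<s. \<bar>C $$ (i, j)\<bar>) * (\<Sum>j<s. cmod (y j))"
    for i and y :: "nat \<Rightarrow> complex"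
  proof -
    have "cmod (\<Sum>j<s. C $$ (i, j) * y j) \<le> (\<Sum>j<s. \<bar>C $$ (i, j)\<bar> * cmod (y j))"
      by (rule order.trans[OF norm_sum]) (simp add: norm_mult)
    also have "\<dots> \<le> (\<Sum>j<s. \<bar>C $$ (i, j)\<bar> * (\<Sum>l<s. cmod (y l)))"
      by (intro sum_mono mult_left_mono member_le_sum) auto
    finally show ?thesis by (simp add: sum_distrib_right)
  qed
  have C_bound: "(\<Sum>i<s. cmod (\<Sum>j<s. C $$ (i, j) * y j)) \<le> K * (\<Sum>j<s. cmod (y j))"
    for y :: "nat \<Rightarrow> complex"
    unfolding K_def sum_distrib_right by (intro sum_mono row_bound[unfolded sum_distrib_right])
  have CAent: "(\<Sum>l<s. C $$ (i, l) * A $$ (l, j)) = (if i = j then 1 else 0)"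
    if "i < s" "j < s" for i j
    using arg_cong[OF CA, of "\<lambda>X. X $$ (i, j)"] that A C
    by (simp add: scalar_prod_def lessThan_atLeast0)
  have bound: "cmod (stability_function s A b z) \<le> P * (K / (norm z - K))" if z: "K < norm z" for z
  proof -
    have inv: "invertible_mat (stage_mat s A z)"
    proof (rule ccontr)
      assume "\<not> ?thesis"
      then obtain v where v: "v \<in> carrier_vec s" "v \<noteq> 0\<^sub>v s"
        and Cv: "map_mat complex_of_real C *\<^sub>v v = z \<cdot>\<^sub>v v"
        using singular_stage_mat_imp_eigenvalue_inverse[OF A C CA] C
        unfolding eigenvalue_def eigenvector_def by auto
      have cC: "map_mat complex_of_real C \<in> carrier_mat s s" using C by simp
      define N where "N = (\<Sum>i<s. cmod (v $ i))"
      have Ci: "(\<Sum>j<s. C $$ (i, j) * v $ j) = z * v $ i" if i: "i < s" for i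
      proof -
        have "(\<Sum>j<s. C $$ (i, j) * v $ j) = (map_mat complex_of_real C *\<^sub>v v) $ i"
          unfolding mult_mat_vec_index[OF cC v(1) i] using C i by (intro sum.cong refl) simp
        then show ?thesis using v(1) i by (simp only: Cv) simp
      qed
      have "norm z * N = (\<Sum>i<s. cmod (\<Sum>j<s. C $$ (i, j) * v $ j))"
        by (simp add: N_def sum_distrib_left norm_mult Ci)
      also have "\<dots> \<le> K * N" unfolding N_def by (rule C_bound)
      finally have "(norm z - K) * N \<le> 0" by (simp add: algebra_simps)
      then have "N \<le> 0" using z by (simp add: mult_le_0_iff)
      then have "N = 0" unfolding N_def by (simp add: order.antisym sum_nonneg)
      then have "v = 0\<^sub>v s" using v(1) by (auto simp: N_def sum_nonneg_eq_0_iff)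
      with v(2) show False by simp
    qed
    obtain x :: "nat \<Rightarrow> complex" where x: "\<And>i. i < s \<Longrightarrow> x i = 1 + z * (\<Sum>j<s. A $$ (i, j) * x j)"
      and R: "stability_function s A b z = 1 + z * (\<Sum>j<s. b $ j * x j)"
      by (rule stability_function_stages[OF A b inv]) (rule that)
    \<comment> \<open>Multiplying the stage equations by \<open>C\<close> moves the factor \<open>z\<close> from \<open>A x\<close> to \<open>x\<close>.\<close>
    have zx: "z * x i = (\<Sum>j<s. C $$ (i, j) * x j) - (\<Sum>j<s. of_real (C $$ (i, j)))"
      if i: "i < s" for i
    proof -
      have "(\<Sum>l<s. C $$ (i, l) * x l) =
          (\<Sum>l<s. C $$ (i, l) + z * (\<Sum>j<s. C $$ (i, l) * A $$ (l, j) * x j))"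
      proof (intro sum.cong refl)
        fix l assume "l \<in> {..<s}"
        then have "x l = 1 + z * (\<Sum>j<s. A $$ (l, j) * x j)" using x by blast
        then have "C $$ (i, l) * x l = C $$ (i, l) * (1 + z * (\<Sum>j<s. A $$ (l, j) * x j))"
          by (rule arg_cong)
        then show "C $$ (i, l) * x l =
            C $$ (i, l) + z * (\<Sum>j<s. C $$ (i, l) * A $$ (l, j) * x j)"
          by (simp only: distrib_left mult_1_right sum_distrib_left of_real_mult mult_ac mult_1_left)
      qed
      also have "\<dots> = (\<Sum>l<s. of_real (C $$ (i, l))) +
          z * (\<Sum>l<s. \<Sum>j<s. C $$ (i, l) * A $$ (l, j) * x j)"
        by (simp add: sum.distrib sum_distrib_left)
      also have "(\<Sum>l<s. \<Sum>j<s. C $$ (i, l) * A $$ (l, j) * x j) =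
          (\<Sum>j<s. of_real (\<Sum>l<s. C $$ (i, l) * A $$ (l, j)) * x j)"
        by (subst sum.swap) (simp add: sum_distrib_right)
      also have "\<dots> = (\<Sum>j<s. if i = j then x j else 0)"
        using i by (intro sum.cong refl) (simp add: CAent)
      finally show ?thesis using i by simp
    qed
    define N where "N = (\<Sum>i<s. cmod (x i))"
    have "norm z * N = (\<Sum>i<s. cmod (z * x i))" by (simp add: N_def sum_distrib_left norm_mult)
    also have "\<dots> \<le> (\<Sum>i<s. cmod (\<Sum>j<s. C $$ (i, j) * x j) + (\<Sum>j<s. \<bar>C $$ (i, j)\<bar>))"
    proof (rule sum_mono)
      fix i assume "i \<in> {..<s}"
      then have "cmod (z * x i) \<le> cmod (\<Sum>j<s. C $$ (i, j) * x j) + cmod (\<Sum>j<s. of_real (C $$ (i, j)))"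
        by (simp add: zx norm_triangle_ineq4)
      also have "cmod (\<Sum>j<s. of_real (C $$ (i, j))) \<le> (\<Sum>j<s. \<bar>C $$ (i, j)\<bar>)"
        by (rule order.trans[OF norm_sum]) simp
      finally show "cmod (z * x i) \<le> cmod (\<Sum>j<s. C $$ (i, j) * x j) + (\<Sum>j<s. \<bar>C $$ (i, j)\<bar>)"
        by simp
    qed
    also have "\<dots> \<le> K * N + K" unfolding sum.distrib using C_bound[of x] by (simp add: N_def K_def)
    finally have N: "N \<le> K / (norm z - K)" using z by (simp add: field_simps)
    have "stability_function s A b z = 1 + (\<Sum>i<s. b $ i * (z * x i))"
      unfolding R by (simp add: sum_distrib_left mult.left_commute)
    also have "\<dots> = 1 + (\<Sum>i<s. b $ i * (\<Sum>j<s. C $$ (i, j) * x j)) -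
        of_real (\<Sum>i<s. b $ i * (\<Sum>j<s. C $$ (i, j)))"
      by (simp add: zx sum_subtractf right_diff_distrib)
    also have "(\<Sum>i<s. b $ i * (\<Sum>j<s. C $$ (i, j))) = 1"
    proof -
      have o: "(ones s :: real vec) \<in> carrier_vec s" by (rule ones_carrier)
      have "(C *\<^sub>v ones s) $ i = (\<Sum>j<s. C $$ (i, j))" if "i < s" for i
        unfolding mult_mat_vec_index[OF C o that] by (simp add: ones_def)
      then have "scalar_prod b (C *\<^sub>v ones s) = (\<Sum>i<s. b $ i * (\<Sum>j<s. C $$ (i, j)))"
        unfolding scalar_prod_sum[OF mult_mat_vec_carrier[OF C o]]
        by (intro sum.cong refl) (simp del: index_mult_mat_vec)
      then show ?thesis using row by simp
    qed
    finally have "stability_function s A b z = (\<Sum>i<s. b $ i * (\<Sum>j<s. C $$ (i, j) * x j))"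
      by simp
    also have "cmod \<dots> \<le> (\<Sum>i<s. \<bar>b $ i\<bar> * ((\<Sum>j<s. \<bar>C $$ (i, j)\<bar>) * N))"
    proof (rule order.trans[OF norm_sum], rule sum_mono)
      fix i
      show "cmod (b $ i * (\<Sum>j<s. C $$ (i, j) * x j)) \<le>
          \<bar>b $ i\<bar> * ((\<Sum>j<s. \<bar>C $$ (i, j)\<bar>) * N)"
        using row_bound[of i x] by (simp add: norm_mult N_def mult_left_mono)
    qed
    also have "\<dots> = P * N" by (simp add: P_def sum_distrib_right mult.assoc)
    also have "\<dots> \<le> P * (K / (norm z - K))"
      unfolding P_def by (intro mult_left_mono N sum_nonneg mult_nonneg_nonneg) auto
    finally show ?thesis .
  qed
  have "((\<lambda>z :: complex. P * (K / (norm z - K))) \<longlongrightarrow> P * 0) at_infinity"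
  proof (intro tendsto_mult tendsto_const tendsto_divide_0[OF tendsto_const]
      filterlim_at_top_imp_at_infinity)
    show "filterlim (\<lambda>z :: complex. norm z - K) at_top at_infinity"
      using filterlim_tendsto_add_at_top[OF tendsto_const[of "- K"] filterlim_norm_at_top[where 'a = complex]]
      by (simp add: add.commute)
  qed
  then have lim: "((\<lambda>z :: complex. P * (K / (norm z - K))) \<longlongrightarrow> 0) at_infinity" by simp
  have ev: "\<forall>\<^sub>F z in at_infinity. cmod (stability_function s A b z) \<le> P * (K / (norm z - K))"
    unfolding eventually_at_infinity by (intro exI[of _ "K + 1"] allI impI bound) simp
  have "((\<lambda>z. cmod (stability_function s A b z)) \<longlongrightarrow> 0) at_infinity"
    by (rule tendsto_sandwich[OF _ ev tendsto_const lim]) simp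
  then show ?thesis by (rule tendsto_norm_zero_cancel)
qed

section \<open>The algebraic stability form\<close>

lemma scalar_prod_add_transpose:
  fixes G :: "real mat"
  assumes G: "G \<in> carrier_mat s s" and x: "x \<in> carrier_vec s"
  shows "scalar_prod x ((G + transpose_mat G) *\<^sub>v x) = 2 * scalar_prod x (G *\<^sub>v x)"
proof -
  have "scalar_prod x (transpose_mat G *\<^sub>v x) = scalar_prod x (G *\<^sub>v x)"
    using transpose_vec_mult_scalar[OF G x x] comm_scalar_prod[OF x, of "transpose_mat G *\<^sub>v x"] G x
    by simp
  then show ?thesis
    using G x by (simp add: add_mult_distrib_mat_vec[of _ s s] scalar_prod_add_distrib[of _ s])
qed

lemma outer_carrier: "u \<in> carrier_vec n \<Longrightarrow> v \<in> carrier_vec m \<Longrightarrow> outer u v \<in> carrier_mat n m"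
  by (auto simp: outer_def)

lemma outer_mult_vec:
  fixes u :: "'a :: comm_semiring_0 vec"
  assumes "u \<in> carrier_vec n" "v \<in> carrier_vec m" "x \<in> carrier_vec m"
  shows "outer u v *\<^sub>v x = scalar_prod v x \<cdot>\<^sub>v u"
proof (rule eq_vecI)
  show "(outer u v *\<^sub>v x) $ i = (scalar_prod v x \<cdot>\<^sub>v u) $ i" if "i < dim_vec (scalar_prod v x \<cdot>\<^sub>v u)" for i
    using assms that by (simp add: outer_def scalar_prod_def sum_distrib_left mult_ac)
qed (use assms in \<open>simp add: outer_def\<close>)

lemma pos_semidef_algebraic_stability_matI:
  assumes A: "A \<in> carrier_mat s s" and b: "b \<in> carrier_vec s"
    and form: "\<And>x. x \<in> carrier_vec s \<Longrightarrow>
      (scalar_prod b x)\<^sup>2 \<le> 2 * scalar_prod x ((mat_diag s (vec_index b) * A) *\<^sub>v x)"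
  shows "pos_semidef s
     (mat_diag s (vec_index b) * A + transpose_mat A * mat_diag s (vec_index b) - outer b b)"
    (is "pos_semidef s ?Q")
  unfolding pos_semidef_def
proof (intro conjI ballI)
  let ?G = "mat_diag s (vec_index b) * A"
  have G: "?G \<in> carrier_mat s s" using A by (simp add: mult_carrier_mat[of _ s s])
  have GT: "transpose_mat A * mat_diag s (vec_index b) = transpose_mat ?G"
    using A by (auto simp: mat_diag_mult_left[of A s s] mat_diag_mult_right[of "transpose_mat A" s s])
  show Q: "?Q \<in> carrier_mat s s" using b by (auto simp: outer_def)
  show "symmetric_mat ?Q"
    unfolding symmetric_mat_def
  proof (rule eq_matI)
    fix i j assume "i < dim_row ?Q" "j < dim_col ?Q"
    then have "i < s" "j < s" using Q by auto
    then show "transpose_mat ?Q $$ (i, j) = ?Q $$ (i, j)"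
      using Q by (simp add: algebraic_stability_entry[OF A b]
          del: index_add_mat index_minus_mat index_mult_mat)
  qed (use b in \<open>auto simp: outer_def\<close>)
  fix x :: "real vec" assume x: "x \<in> carrier_vec s"
  have "scalar_prod x (?Q *\<^sub>v x) =
      scalar_prod x ((?G + transpose_mat ?G) *\<^sub>v x) - scalar_prod x (outer b b *\<^sub>v x)"
    unfolding GT using G x outer_carrier[OF b b]
    by (subst minus_mult_distrib_mat_vec[of _ s s])
      (auto intro!: scalar_prod_minus_distrib[of _ s] mult_mat_vec_carrier[of _ s s])
  also have "\<dots> = 2 * scalar_prod x (?G *\<^sub>v x) - (scalar_prod b x)\<^sup>2"
    unfolding scalar_prod_add_transpose[OF G x] outer_mult_vec[OF b b x] using b x
    by (simp add: power2_eq_square comm_scalar_prod[OF x b])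
  finally show "0 \<le> scalar_prod x (?Q *\<^sub>v x)" using form[OF x] by simp
qed

lemma pos_def_imp_invertible:
  assumes "pos_def s M"
  shows "invertible_mat M"
proof (rule invertible_mat_if_trivial_kernel)
  show "M \<in> carrier_mat s s" using assms by (simp add: pos_def_def)
  fix v assume "v \<in> carrier_vec s" "M *\<^sub>v v = 0\<^sub>v s"
  then show "v = 0\<^sub>v s" using assms unfolding pos_def_def by (metis less_irrefl scalar_prod_right_zero)
qed

section \<open>SBP SAT schemes\<close>

locale sbp_sat =
  fixes T :: real and s :: nat and \<tau> :: "real vec" and p :: nat and D M :: "real mat"
    and t\<^sub>L t\<^sub>R :: "real vec"
  assumes sbp: "sbp_operator T s \<tau> p D M t\<^sub>L t\<^sub>R" and eig: "eigenvalue_assumption D M t\<^sub>L"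
begin

definition "B = D + mat_inv M * outer t\<^sub>L t\<^sub>L"

lemma T_pos: "0 < T" and D_carrier: "D \<in> carrier_mat s s" and M_carrier: "M \<in> carrier_mat s s"
  and tL_carrier: "t\<^sub>L \<in> carrier_vec s" and tR_carrier: "t\<^sub>R \<in> carrier_vec s" and tau_carrier: "\<tau> \<in> carrier_vec s"
  using sbp by (auto simp: sbp_operator_def pos_def_def grid_def)

lemma M_sym: "transpose_mat M = M"
  using sbp by (auto simp: sbp_operator_def pos_def_def symmetric_mat_def)

lemmas M_inv = mat_inv_inverts[OF M_carrier pos_def_imp_invertible]

lemma ones_real_carrier: "(ones s :: real vec) \<in> carrier_vec s" by (rule ones_carrier)

lemma M_pos_def: "pos_def s M" using sbp by (simp add: sbp_operator_def)

lemma B_carrier: "B \<in> carrier_mat s s"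
  unfolding B_def using D_carrier M_inv(1)[OF M_pos_def] outer_carrier[OF tL_carrier tL_carrier] by (meson add_carrier_mat mult_carrier_mat)

text \<open>The scheme itself is the case \<open>\<sigma> = 1\<close> of the eigenvalue assumption.\<close>

lemma eigenvalue_B: "eigenvalue (map_mat complex_of_real B) \<mu> \<Longrightarrow> 0 < Re \<mu>"
proof -
  have "(1 :: real) \<cdot>\<^sub>m (mat_inv M * outer t\<^sub>L t\<^sub>L) = mat_inv M * outer t\<^sub>L t\<^sub>L" by auto
  then show "eigenvalue (map_mat complex_of_real B) \<mu> \<Longrightarrow> 0 < Re \<mu>"
    using eig[unfolded eigenvalue_assumption_def, rule_format, of 1 \<mu>] by (simp add: B_def)
qed

lemma B_invertible: "invertible_mat B"
proof (rule invertible_mat_if_trivial_kernel[OF B_carrier], rule ccontr)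
  fix v assume v: "v \<in> carrier_vec s" "B *\<^sub>v v = 0\<^sub>v s" "v \<noteq> 0\<^sub>v s"
  let ?v = "map_vec complex_of_real v"
  have "map_mat complex_of_real B *\<^sub>v ?v = map_vec complex_of_real (B *\<^sub>v v)"
    by (rule of_real_hom.mult_mat_vec_hom[OF B_carrier v(1), symmetric])
  then have "map_mat complex_of_real B *\<^sub>v ?v = 0 \<cdot>\<^sub>v ?v"
    using v(1) by (auto simp: v(2) of_real_hom.vec_hom_zero)
  moreover have "?v \<noteq> 0\<^sub>v s" using v(3) by simp
  ultimately have "eigenvalue (map_mat complex_of_real B) 0"
    using v(1) B_carrier unfolding eigenvalue_def eigenvector_def by (intro exI[of _ ?v]) auto
  then show False using eigenvalue_B by fastforce
qed

lemmas B_inv = mat_inv_inverts[OF B_carrier B_invertible]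

lemma M_mult_B: "M * B = M * D + outer t\<^sub>L t\<^sub>L"
proof -
  have "M * (mat_inv M * outer t\<^sub>L t\<^sub>L) = outer t\<^sub>L t\<^sub>L"
    using assoc_mult_mat[OF M_carrier M_inv(1)[OF M_pos_def] outer_carrier[OF tL_carrier tL_carrier]] M_inv(2)[OF M_pos_def]
      outer_carrier[OF tL_carrier tL_carrier] by simp
  then show ?thesis
    unfolding B_def
    using mult_add_distrib_mat[OF M_carrier D_carrier mult_carrier_mat[OF M_inv(1)[OF M_pos_def] outer_carrier[OF tL_carrier tL_carrier]]]
    by simp
qed

text \<open>The boundary term of the scheme adds \<open>t\<^sub>L t\<^sub>L\<^sup>T\<close> twice, which turns the indefinite right-hand
  side of the summation by parts rule into a positive semidefinite one.\<close>

lemma M_mult_B_plus_transpose: "M * B + transpose_mat (M * B) = outer t\<^sub>R t\<^sub>R + outer t\<^sub>L t\<^sub>L"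
proof -
  have "M * D + transpose_mat D * M = outer t\<^sub>R t\<^sub>R - outer t\<^sub>L t\<^sub>L"
    using sbp by (simp add: sbp_operator_def)
  moreover have "transpose_mat (M * D) = transpose_mat D * M"
    using transpose_mult[OF M_carrier D_carrier] M_sym by simp
  ultimately have *: "M * D + transpose_mat (M * D) = outer t\<^sub>R t\<^sub>R - outer t\<^sub>L t\<^sub>L" by simp
  have MD: "M * D \<in> carrier_mat s s" using M_carrier D_carrier by simp
  show ?thesis
  proof (rule eq_matI)
    fix i j assume "i < dim_row (outer t\<^sub>R t\<^sub>R + outer t\<^sub>L t\<^sub>L)" "j < dim_col (outer t\<^sub>R t\<^sub>R + outer t\<^sub>L t\<^sub>L)"
    then have ij: "i < s" "j < s" using tL_carrier by (auto simp: outer_def)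
    have "(M * D) $$ (i, j) + (M * D) $$ (j, i) = t\<^sub>R $ i * t\<^sub>R $ j - t\<^sub>L $ i * t\<^sub>L $ j"
    proof -
      have "(M * D) $$ (i, j) + (M * D) $$ (j, i) = (M * D + transpose_mat (M * D)) $$ (i, j)"
        using ij M_carrier D_carrier by (simp del: index_mult_mat(1))
      also have "\<dots> = t\<^sub>R $ i * t\<^sub>R $ j - t\<^sub>L $ i * t\<^sub>L $ j"
        unfolding * using ij tL_carrier tR_carrier by (simp add: outer_def)
      finally show ?thesis .
    qed
    then show "(M * B + transpose_mat (M * B)) $$ (i, j) = (outer t\<^sub>R t\<^sub>R + outer t\<^sub>L t\<^sub>L) $$ (i, j)"
      unfolding M_mult_B using ij MD tL_carrier tR_carrier by (auto simp: outer_def simp del: index_mult_mat(1))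
  qed (use M_carrier B_carrier tL_carrier in \<open>auto simp: outer_def\<close>)
qed

lemma exact_on_linear:
  "D *\<^sub>v ones s = 0\<^sub>v s" "D *\<^sub>v \<tau> = ones s"
  "scalar_prod t\<^sub>L (ones s) = 1" "scalar_prod t\<^sub>R (ones s) = 1"
proof -
  have 1: "nodal_values \<tau> [:1:] = ones s" "nodal_values \<tau> [:0, 1:] = \<tau>" "nodal_values \<tau> 0 = 0\<^sub>v s"
    using tau_carrier by (auto simp: nodal_values_def ones_def)
  have ex: "\<And>q. degree q \<le> p \<Longrightarrow>
        D *\<^sub>v nodal_values \<tau> q = nodal_values \<tau> (pderiv q) \<and>
        scalar_prod t\<^sub>L (nodal_values \<tau> q) = poly q 0 \<and>
        scalar_prod t\<^sub>R (nodal_values \<tau> q) = poly q T" and p: "1 \<le> p"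
    using sbp by (auto simp: sbp_operator_def)
  show "D *\<^sub>v ones s = 0\<^sub>v s" "scalar_prod t\<^sub>L (ones s) = 1" "scalar_prod t\<^sub>R (ones s) = 1"
    using ex[of "[:1:]"] by (simp_all add: 1[unfolded one_pCons[symmetric]] 1 pderiv_pCons)
  show "D *\<^sub>v \<tau> = ones s"
    using ex[of "[:0, 1:]"] p by (simp add: 1 pderiv_pCons)
qed

text \<open>Differentiation annihilates constants, so \<open>M B 1 = t\<^sub>L\<close>; the summation by parts rule at
  \<open>1\<close> then leaves \<open>t\<^sub>R\<close> for the transpose.\<close>

lemma transpose_MB_ones: "transpose_mat (M * B) *\<^sub>v ones s = t\<^sub>R"
proof -
  have MB': "M * B \<in> carrier_mat s s" "M * D \<in> carrier_mat s s" using M_carrier B_carrier D_carrier by auto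
  have "(M * D) *\<^sub>v ones s = 0\<^sub>v s"
    unfolding assoc_mult_mat_vec[OF M_carrier D_carrier ones_real_carrier] exact_on_linear(1) using M_carrier by auto
  then have 1: "(M * B) *\<^sub>v ones s = t\<^sub>L"
    unfolding M_mult_B using add_mult_distrib_mat_vec[OF MB'(2) outer_carrier[OF tL_carrier tL_carrier] ones_real_carrier]
      outer_mult_vec[OF tL_carrier tL_carrier ones_real_carrier] exact_on_linear(3) tL_carrier by simp
  have MBT: "transpose_mat (M * B) \<in> carrier_mat s s" using MB'(1) by simp
  have "(M * B) *\<^sub>v ones s + transpose_mat (M * B) *\<^sub>v ones s =
      (outer t\<^sub>R t\<^sub>R + outer t\<^sub>L t\<^sub>L) *\<^sub>v ones s"
    unfolding M_mult_B_plus_transpose[symmetric] by (rule add_mult_distrib_mat_vec[OF MB'(1) MBT ones_real_carrier, symmetric])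
  also have "\<dots> = t\<^sub>R + t\<^sub>L"
    unfolding add_mult_distrib_mat_vec[OF outer_carrier[OF tR_carrier tR_carrier] outer_carrier[OF tL_carrier tL_carrier] ones_real_carrier]
      outer_mult_vec[OF tR_carrier tR_carrier ones_real_carrier] outer_mult_vec[OF tL_carrier tL_carrier ones_real_carrier] exact_on_linear by simp
  finally have eq: "t\<^sub>L + transpose_mat (M * B) *\<^sub>v ones s = t\<^sub>R + t\<^sub>L" unfolding 1 .
  show ?thesis
  proof (rule eq_vecI)
    fix i assume "i < dim_vec t\<^sub>R"
    then show "(transpose_mat (M * B) *\<^sub>v ones s) $ i = t\<^sub>R $ i"
      using arg_cong[OF eq, of "\<lambda>v. v $ i"] tL_carrier tR_carrier M_carrier B_carrier
      by (simp del: index_mult_mat_vec transpose_mult)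
  qed (use tR_carrier M_carrier B_carrier in simp)
qed

text \<open>Up to the factor \<open>T\<close>, the left-hand side is \<open>b\<^sup>T B y\<close>. This is used twice: with arbitrary
  \<open>y\<close> it computes the term \<open>b b\<^sup>T\<close> of the algebraic stability form, and with \<open>y = 1\<close> it shows
  that the stability function vanishes at infinity.\<close>

lemma ones_M_B_eq_right_boundary:
  assumes y: "y \<in> carrier_vec s"
  shows "scalar_prod (M *\<^sub>v ones s) (B *\<^sub>v y) = scalar_prod t\<^sub>R y"
proof -
  have "scalar_prod (M *\<^sub>v ones s) (B *\<^sub>v y) = scalar_prod (transpose_mat M *\<^sub>v ones s) (B *\<^sub>v y)"
    by (simp only: M_sym)
  also have "\<dots> = scalar_prod (ones s) (M *\<^sub>v (B *\<^sub>v y))"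
    using M_carrier B_carrier y ones_real_carrier by (intro transpose_vec_mult_scalar) auto
  also have "\<dots> = scalar_prod (transpose_mat (M * B) *\<^sub>v ones s) y"
    using transpose_vec_mult_scalar[of "M * B" s s y "ones s"] M_carrier B_carrier y ones_real_carrier by simp
  finally show ?thesis unfolding transpose_MB_ones .
qed

lemma energy_form:
  assumes y: "y \<in> carrier_vec s"
  shows "2 * scalar_prod (B *\<^sub>v y) (M *\<^sub>v y) = (scalar_prod t\<^sub>R y)\<^sup>2 + (scalar_prod t\<^sub>L y)\<^sup>2"
proof -
  have MB': "M * B \<in> carrier_mat s s" using M_carrier B_carrier by auto
  have By: "B *\<^sub>v y \<in> carrier_vec s" using B_carrier y by simp
  have "scalar_prod (B *\<^sub>v y) (M *\<^sub>v y) = scalar_prod (transpose_mat M *\<^sub>v (B *\<^sub>v y)) y"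
    using transpose_vec_mult_scalar[OF M_carrier y By] by simp
  also have "\<dots> = scalar_prod y ((M * B) *\<^sub>v y)"
    using M_carrier B_carrier y By by (simp add: M_sym comm_scalar_prod[OF y, of "M *\<^sub>v (B *\<^sub>v y)"])
  finally have "2 * scalar_prod (B *\<^sub>v y) (M *\<^sub>v y) =
      scalar_prod y ((M * B + transpose_mat (M * B)) *\<^sub>v y)"
    using scalar_prod_add_transpose[OF MB' y] by simp
  also have "\<dots> = (scalar_prod t\<^sub>R y)\<^sup>2 + (scalar_prod t\<^sub>L y)\<^sup>2"
    unfolding M_mult_B_plus_transpose using y tL_carrier tR_carrier
    by (simp add: add_mult_distrib_mat_vec[of _ s s] outer_carrier outer_mult_vec
        scalar_prod_add_distrib[of _ s] power2_eq_square comm_scalar_prod[OF y tL_carrier] comm_scalar_prod[OF y tR_carrier])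
  finally show ?thesis .
qed

definition "A = (1 / T) \<cdot>\<^sub>m mat_inv B"
definition "b = (1 / T) \<cdot>\<^sub>v (M *\<^sub>v ones s)"

lemma A_carrier: "A \<in> carrier_mat s s" and b_carrier: "b \<in> carrier_vec s"
  using B_inv(1) M_carrier ones_real_carrier by (auto simp: A_def b_def)

lemma inverse_A: "T \<cdot>\<^sub>m B \<in> carrier_mat s s" "A * (T \<cdot>\<^sub>m B) = 1\<^sub>m s" "(T \<cdot>\<^sub>m B) * A = 1\<^sub>m s"
proof -
  show "T \<cdot>\<^sub>m B \<in> carrier_mat s s" using B_carrier by simp
  show "A * (T \<cdot>\<^sub>m B) = 1\<^sub>m s" "(T \<cdot>\<^sub>m B) * A = 1\<^sub>m s"
    using B_carrier B_inv T_pos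
    by (auto simp: A_def mult_smult_assoc_mat[of _ s s] mult_smult_distrib[of _ s s])
qed

lemma stage_mat_invertible:
  assumes "Re z \<le> 0"
  shows "invertible_mat (stage_mat s A z)"
proof (rule ccontr)
  assume "\<not> ?thesis"
  then have "eigenvalue (map_mat complex_of_real (T \<cdot>\<^sub>m B)) z"
    by (rule singular_stage_mat_imp_eigenvalue_inverse[OF A_carrier inverse_A(1,3)])
  moreover have "map_mat complex_of_real (T \<cdot>\<^sub>m B) = complex_of_real T \<cdot>\<^sub>m map_mat complex_of_real B"
    by auto
  ultimately obtain v where v: "v \<in> carrier_vec s" "v \<noteq> 0\<^sub>v s"
    and Bv: "complex_of_real T \<cdot>\<^sub>v (map_mat complex_of_real B *\<^sub>v v) = z \<cdot>\<^sub>v v"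
    using B_carrier unfolding eigenvalue_def eigenvector_def
    by (auto simp: smult_mat_mult_vec[of _ s s])
  have "map_mat complex_of_real B *\<^sub>v v = (1 / T) \<cdot>\<^sub>v (complex_of_real T \<cdot>\<^sub>v (map_mat complex_of_real B *\<^sub>v v))"
    using T_pos by (simp add: smult_smult_assoc)
  then have "map_mat complex_of_real B *\<^sub>v v = (z / T) \<cdot>\<^sub>v v"
    unfolding Bv by (simp add: smult_smult_assoc)
  then have "eigenvalue (map_mat complex_of_real B) (z / T)"
    using v B_carrier unfolding eigenvalue_def eigenvector_def by auto
  from eigenvalue_B[OF this] show False using assms T_pos by (simp add: zero_less_divide_iff)
qed

text \<open>Algebraic stability is about \<open>diag b\<close>, the energy estimate of the scheme about \<open>M\<close>. For
  diagonal \<open>M\<close> the two agree up to the factor \<open>T\<close>, because then \<open>M 1\<close> lists the diagonal of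
  \<open>M\<close>.\<close>

lemma diagonal_imp_stable_rk:
  assumes diag: "diagonal_mat M"
  shows "stable_rk TYPE('h :: {real_inner, complete_space}) s A b ((1 / T) \<cdot>\<^sub>v \<tau>)"
proof -
  have b_index: "b $ i = M $$ (i, i) / T" if i: "i < s" for i
  proof -
    have "(M *\<^sub>v ones s) $ i = (\<Sum>j<s. if j = i then M $$ (i, j) else 0)"
      unfolding mult_mat_vec_index[OF M_carrier ones_real_carrier i] using diag M_carrier i
      by (intro sum.cong refl) (auto simp: ones_def diagonal_mat_def)
    then show ?thesis using i M_carrier by (simp add: b_def del: index_mult_mat_vec)
  qed
  have b_pos: "0 < b $ i" if i: "i < s" for i
  proof -
    have "0 < scalar_prod (unit_vec s i) (M *\<^sub>v unit_vec s i)"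
      using M_pos_def i by (simp add: pos_def_def)
    also have "\<dots> = M $$ (i, i)"
      using M_carrier i by simp
    finally show ?thesis using T_pos i by (simp add: b_index)
  qed
  have diagb: "mat_diag s (vec_index b) = (1 / T) \<cdot>\<^sub>m M"
    using M_carrier diag by (auto simp: mat_diag_def b_index diagonal_mat_def)
  have stab: "algebraically_stable s A b"
    unfolding algebraically_stable_def
  proof (intro conjI pos_semidef_algebraic_stability_matI A_carrier b_carrier)
    show "\<forall>i<s. 0 \<le> b $ i" using b_pos by (simp add: less_imp_le)
    fix x :: "real vec" assume x: "x \<in> carrier_vec s"
    \<comment> \<open>In the coordinates \<open>x = B y\<close> the matrix \<open>B\<^sup>-\<^sup>1\<close> disappears from the form.\<close>
    define y where "y = mat_inv B *\<^sub>v x"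
    have y: "y \<in> carrier_vec s" using B_inv(1) x by (simp add: y_def)
    have xy: "x = B *\<^sub>v y"
      using assoc_mult_mat_vec[OF B_carrier B_inv(1) x] B_inv(2) x by (simp add: y_def)
    have My: "M *\<^sub>v y \<in> carrier_vec s" using M_carrier y by simp
    have Ax: "A *\<^sub>v x = (1 / T) \<cdot>\<^sub>v y"
      using B_inv(1) x by (simp add: A_def y_def smult_mat_mult_vec[of _ s s])
    have "(mat_diag s (vec_index b) * A) *\<^sub>v x = (1 / T) \<cdot>\<^sub>v (M *\<^sub>v ((1 / T) \<cdot>\<^sub>v y))"
      unfolding diagb using M_carrier A_carrier x y
      by (simp add: Ax smult_mat_mult_vec[of _ s s] assoc_mult_mat_vec[of _ s s _ s])
    then have "2 * scalar_prod x ((mat_diag s (vec_index b) * A) *\<^sub>v x) =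
        (1 / T)\<^sup>2 * (2 * scalar_prod x (M *\<^sub>v y))"
      using M_carrier x y My by (simp add: mult_mat_vec[of _ s s] power2_eq_square)
    also have "\<dots> = (1 / T)\<^sup>2 * ((scalar_prod t\<^sub>R y)\<^sup>2 + (scalar_prod t\<^sub>L y)\<^sup>2)"
      using energy_form[OF y] by (simp add: xy[symmetric])
    finally have 1: "2 * scalar_prod x ((mat_diag s (vec_index b) * A) *\<^sub>v x) =
        (1 / T)\<^sup>2 * ((scalar_prod t\<^sub>R y)\<^sup>2 + (scalar_prod t\<^sub>L y)\<^sup>2)" .
    have "scalar_prod b x = (1 / T) * scalar_prod t\<^sub>R y"
      using ones_M_B_eq_right_boundary[OF y] M_carrier ones_real_carrier x by (simp add: b_def xy[symmetric])
    then show "(scalar_prod b x)\<^sup>2 \<le> 2 * scalar_prod x ((mat_diag s (vec_index b) * A) *\<^sub>v x)"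
      unfolding 1 by (simp add: power_divide divide_right_mono)
  qed
  have Astab: "A_stable s A b"
    using algebraically_stable_imp_A_stable[OF A_carrier b_carrier stab] stage_mat_invertible by blast
  have "scalar_prod b ((T \<cdot>\<^sub>m B) *\<^sub>v ones s) = 1"
    using ones_M_B_eq_right_boundary[OF ones_real_carrier] exact_on_linear(4) M_carrier B_carrier ones_real_carrier T_pos
    by (simp add: b_def smult_mat_mult_vec[of _ s s])
  then have "L_stable s A b"
    using Astab stability_function_tendsto_0[OF A_carrier b_carrier inverse_A(1,3)] by (simp add: L_stable_def)
  moreover have "\<forall>i<s. 0 \<le> ((1 / T) \<cdot>\<^sub>v \<tau>) $ i \<and> ((1 / T) \<cdot>\<^sub>v \<tau>) $ i \<le> 1"
    using sbp T_pos tau_carrier by (auto simp: sbp_operator_def grid_def)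
  moreover have "\<forall>i<s. \<forall>j<s. i \<noteq> j \<longrightarrow> ((1 / T) \<cdot>\<^sub>v \<tau>) $ i \<noteq> ((1 / T) \<cdot>\<^sub>v \<tau>) $ j"
  proof (intro allI impI)
    fix i j assume ij: "i < s" "j < s" "i \<noteq> j"
    then have "\<tau> $ i \<noteq> \<tau> $ j"
      using sbp unfolding sbp_operator_def grid_def by (metis less_irrefl linorder_neqE_nat)
    then show "((1 / T) \<cdot>\<^sub>v \<tau>) $ i \<noteq> ((1 / T) \<cdot>\<^sub>v \<tau>) $ j" using ij T_pos tau_carrier by simp
  qed
  ultimately show ?thesis
    using Astab stab b_pos algebraically_stable_imp_B_stable[OF A_carrier b_carrier stab]
      invertible_matI[OF A_carrier inverse_A] by (simp add: stable_rk_def)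
qed

text \<open>On one node \<open>D\<close> is a scalar, and \<open>D 1 = 0\<close> contradicts \<open>D \<tau> = 1\<close>.\<close>

lemma stages_ge_2: "2 \<le> s" if "1 \<le> s"
proof (rule ccontr)
  assume "\<not> 2 \<le> s"
  then have s: "s = 1" using that by simp
  have "(D *\<^sub>v ones s) $ 0 = D $$ (0, 0)"
    using mult_mat_vec_index[OF D_carrier ones_real_carrier, of 0] s by (simp add: ones_def del: index_mult_mat_vec)
  then have "D $$ (0, 0) = 0" using exact_on_linear(1) s by simp
  moreover have "(D *\<^sub>v \<tau>) $ 0 = D $$ (0, 0) * \<tau> $ 0"
    using mult_mat_vec_index[OF D_carrier tau_carrier, of 0] s by (simp del: index_mult_mat_vec)
  ultimately show False using exact_on_linear(2) s by (simp add: ones_def)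
qed

end

section \<open>Implicit Euler and the comparison of the two classes\<close>

text \<open>Here \<open>A = b = c = 1\<close>. The algebraic stability form is \<open>1 + 1 - 1\<close>, and the stage matrix
  \<open>1 - z\<close> is singular only at \<open>z = 1\<close>.\<close>

lemma implicit_euler_stable_rk:
  "stable_rk TYPE('h :: {real_inner, complete_space}) 1 (1\<^sub>m 1) (ones 1) (ones 1)"
proof -
  let ?A = "1\<^sub>m 1 :: real mat" and ?b = "ones 1 :: real vec"
  have A: "?A \<in> carrier_mat 1 1" and b: "?b \<in> carrier_vec 1" by (auto simp: ones_def)
  have diag: "mat_diag 1 (vec_index ?b) = 1\<^sub>m 1" by (auto simp: mat_diag_def ones_def)
  have stab: "algebraically_stable 1 ?A ?b"
    unfolding algebraically_stable_def
  proof (intro conjI pos_semidef_algebraic_stability_matI A b)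
    fix x :: "real vec" assume "x \<in> carrier_vec 1"
    then show "(scalar_prod ?b x)\<^sup>2 \<le> 2 * scalar_prod x ((mat_diag 1 (vec_index ?b) * ?A) *\<^sub>v x)"
      unfolding diag by (simp add: scalar_prod_def ones_def power2_eq_square)
  qed (simp add: ones_def)
  have "invertible_mat (stage_mat 1 ?A z)" if "Re z \<le> 0" for z
  proof (rule ccontr)
    assume "\<not> ?thesis"
    then have "eigenvalue (map_mat complex_of_real (1\<^sub>m 1)) z"
      by (intro singular_stage_mat_imp_eigenvalue_inverse[OF A A]) auto
    then obtain v where v: "v \<in> carrier_vec 1" "v \<noteq> 0\<^sub>v 1" "v = z \<cdot>\<^sub>v v"
      unfolding eigenvalue_def eigenvector_def by (auto simp: of_real_hom.mat_hom_one)
    then have "v $ 0 \<noteq> 0" "v $ 0 = z * v $ 0" by (auto simp: vec_eq_iff)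
    then have "z = 1" by simp
    then show False using that by simp
  qed
  then have "A_stable 1 ?A ?b" by (rule algebraically_stable_imp_A_stable[OF A b stab])
  moreover have "(stability_function 1 ?A ?b \<longlongrightarrow> 0) at_infinity"
    by (rule stability_function_tendsto_0[OF A b A]) (auto simp: ones_def scalar_prod_def)
  ultimately show ?thesis
    using stab algebraically_stable_imp_B_stable[OF A b stab] invertible_matI[OF A A]
    by (simp add: stable_rk_def L_stable_def ones_def)
qed

theorem theorem2p3:
  shows "(\<forall>s A b c. runge_kutta s A b c \<and>
            (\<exists>M. induced_by_sbp_sat s A b c M \<and> diagonal_mat M) \<longrightarrow>
            stable_rk TYPE('h :: {real_inner, complete_space}) s A b c) \<and>
         (\<exists>s A b c. runge_kutta s A b c \<and> stable_rk TYPE('h) s A b c \<and>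
            \<not> (\<exists>M. induced_by_sbp_sat s A b c M)) \<and>
         (\<forall>s A b c. runge_kutta s A b c \<and> stable_rk TYPE('h) s A b c \<longrightarrow>
            stable_rk TYPE('k :: {real_inner, complete_space}) s A b c)"
proof (intro conjI)
  show "\<forall>s A b c. runge_kutta s A b c \<and>
      (\<exists>M. induced_by_sbp_sat s A b c M \<and> diagonal_mat M) \<longrightarrow> stable_rk TYPE('h) s A b c"
  proof (intro allI impI, elim conjE exE)
    fix s :: nat and A M :: "real mat" and b c :: "real vec"
    assume ind: "induced_by_sbp_sat s A b c M" and diag: "diagonal_mat M"
    from ind obtain T \<tau> p D t\<^sub>L t\<^sub>R where "sbp_operator T s \<tau> p D M t\<^sub>L t\<^sub>R"
      "eigenvalue_assumption D M t\<^sub>L"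
      and eqs: "A = (1 / T) \<cdot>\<^sub>m mat_inv (D + mat_inv M * outer t\<^sub>L t\<^sub>L)"
        "b = (1 / T) \<cdot>\<^sub>v (M *\<^sub>v ones s)" "c = (1 / T) \<cdot>\<^sub>v \<tau>"
      unfolding induced_by_sbp_sat_def by blast
    then interpret sbp: sbp_sat T s \<tau> p D M t\<^sub>L t\<^sub>R by unfold_locales
    show "stable_rk TYPE('h) s A b c"
      using sbp.diagonal_imp_stable_rk[OF diag] unfolding sbp.A_def sbp.b_def sbp.B_def eqs .
  qed
  show "\<exists>s A b c. runge_kutta s A b c \<and> stable_rk TYPE('h) s A b c \<and>
      \<not> (\<exists>M. induced_by_sbp_sat s A b c M)"
  proof (intro exI conjI)
    show "runge_kutta 1 (1\<^sub>m 1) (ones 1) (ones 1)" by (simp add: runge_kutta_def ones_def)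
    show "stable_rk TYPE('h) 1 (1\<^sub>m 1) (ones 1) (ones 1)" by (rule implicit_euler_stable_rk)
    show "\<not> (\<exists>M. induced_by_sbp_sat 1 (1\<^sub>m 1) (ones 1) (ones 1) M)"
    proof
      assume "\<exists>M. induced_by_sbp_sat 1 (1\<^sub>m 1) (ones 1) (ones 1) M"
      then obtain T \<tau> p D M t\<^sub>L t\<^sub>R where "sbp_operator T 1 \<tau> p D M t\<^sub>L t\<^sub>R"
        "eigenvalue_assumption D M t\<^sub>L"
        unfolding induced_by_sbp_sat_def by blast
      then interpret sbp: sbp_sat T 1 \<tau> p D M t\<^sub>L t\<^sub>R by unfold_locales
      show False using sbp.stages_ge_2 by simp
    qed
  qed
  show "\<forall>s A b c. runge_kutta s A b c \<and> stable_rk TYPE('h) s A b c \<longrightarrow> stable_rk TYPE('k) s A b c"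
    using algebraically_stable_imp_B_stable[where 'h = 'k]
    by (auto simp: stable_rk_def runge_kutta_def)
qed

end
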